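(* Let $(\Omega,*,I)$ be a commutative unital quantale. Suppose $A$ and $B$ are completely distributive $\Omega$-lattices. Then the $\Omega$-category $[A\to_\ell B]$ of left adjoints from $A$ to $B$ is a completely distributive $\Omega$-lattice.
   Context: A commutative unital quantale $(\Omega,*,I)$ is a complete lattice $\Omega$ with a commutative, associative binary operation $*$, monotone in each variable, with unit $I$ (not necessarily the top element), such that each $\alpha*(-)$ has a right adjoint $\alpha\to(-)$: $\alpha*\beta\le\gamma\iff\beta\le\alpha\to\gamma$. An $\Omega$-category is a set $A$ with a map $A(-,-):A\times A\to\Omega$ such that $I\le A(a,a)$ and $A(a,b)*A(b,c)\le A(a,c)$. An $\Omega$-functor $f:A\to B$ is a function with $A(a,b)\le B(f(a),f(b))$. The dual is $A^{\rm op}(a,b)=A(b,a)$. $A$ is antisymmetric if $I\le A(a,b)$ and $I\le A(b,a)$ imply $a=b$. $\Omega$ is an $\Omega$-category via $\Omega(\alpha,\beta)=\alpha\to\beta$. $[A,B]$ is the $\Omega$-category of $\Omega$-functors with $[A,B](f,g)=\bigwedge_{x\in A}B(f(x),g(x))$. $\Omega$-functors $f:A\to B$, $g:B\to A$ form an adjunction ($f$ left adjoint of $g$, $g$ right adjoint of $f$) if $B(f(a),b)=A(a,g(b))$ for all $a,b$. $[A\to_\ell B]$ is the subset of $[A,B]$ consisting of the $\Omega$-functors that have a right adjoint, with the hom inherited from $[A,B]$. For $\phi:A\to\Omega$, $\sup\phi$ is an element $a$ with $A(a,x)=\bigwedge_{z}(\phi(z)\to A(z,x))$ for all $x$. A complete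 $\Omega$-lattice is an antisymmetric $\Omega$-category in which every function $A\to\Omega$ has a supremum (equivalently, the Yoneda embedding $\mathbf y:A\to[A^{\rm op},\Omega]$, $\mathbf y(a)(x)=A(x,a)$, has a left adjoint, namely $\sup$). It is completely distributive if $\sup:[A^{\rm op},\Omega]\to A$ has a left adjoint. *)

theory Defs
  imports "HOL-Library.FuncSet"
begin

text \<open>
  The unit \<open>I\<close> of the quantale is \<open>1\<close>. Monotonicity of \<open>*\<close> in each variable is not listed
  because it follows from the adjunction and commutativity. The right adjoint is
  uniquely determined by \<open>residuation\<close>, so making it an operation of the class adds no structure.
\<close>

class comm_unital_quantale = complete_lattice + comm_monoid_mult +
  fixes residual :: "'a \<Rightarrow> 'a \<Rightarrow> 'a" (infixr \<open>\<rightarrow>\<^sub>q\<close> 60)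
  assumes residuation: "\<alpha> * \<beta> \<le> \<gamma> \<longleftrightarrow> \<beta> \<le> \<alpha> \<rightarrow>\<^sub>q \<gamma>"

record ('a, 'q) enriched =
  obj :: "'a set"
  hom :: "'a \<Rightarrow> 'a \<Rightarrow> 'q"

definition omega_category :: "('a, 'q::comm_unital_quantale) enriched \<Rightarrow> bool" where
  "omega_category A \<longleftrightarrow>
     (\<forall>a\<in>obj A. 1 \<le> hom A a a) \<and>
     (\<forall>a\<in>obj A. \<forall>b\<in>obj A. \<forall>c\<in>obj A. hom A a b * hom A b c \<le> hom A a c)"

definition antisymmetric :: "('a, 'q::comm_unital_quantale) enriched \<Rightarrow> bool" where
  "antisymmetric A \<longleftrightarrow>
     (\<forall>a\<in>obj A. \<forall>b\<in>obj A. 1 \<le> hom A a b \<longrightarrow> 1 \<le> hom A b a \<longrightarrow> a = b)"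

definition dual :: "('a, 'q) enriched \<Rightarrow> ('a, 'q) enriched" where
  "dual A = \<lparr>obj = obj A, hom = (\<lambda>a b. hom A b a)\<rparr>"

definition omega :: "('q, 'q::comm_unital_quantale) enriched" where
  "omega = \<lparr>obj = UNIV, hom = (\<lambda>\<alpha> \<beta>. \<alpha> \<rightarrow>\<^sub>q \<beta>)\<rparr>"

text \<open>
  A map out of \<open>A\<close> is represented by a function that is \<open>undefined\<close> outside \<open>obj A\<close>, so that
  equality of functors is equality on \<open>obj A\<close>.
\<close>

definition omega_functor ::
  "('a, 'q::comm_unital_quantale) enriched \<Rightarrow> ('b, 'q) enriched \<Rightarrow> ('a \<Rightarrow> 'b) \<Rightarrow> bool" where
  "omega_functor A B f \<longleftrightarrow>
     f \<in> obj A \<rightarrow>\<^sub>E obj B \<and>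
     (\<forall>a\<in>obj A. \<forall>b\<in>obj A. hom A a b \<le> hom B (f a) (f b))"

definition functor_category ::
  "('a, 'q::comm_unital_quantale) enriched \<Rightarrow> ('b, 'q) enriched \<Rightarrow> ('a \<Rightarrow> 'b, 'q) enriched" where
  "functor_category A B =
     \<lparr>obj = {f. omega_functor A B f}, hom = (\<lambda>f g. INF x\<in>obj A. hom B (f x) (g x))\<rparr>"

definition adjunction ::
  "('a, 'q::comm_unital_quantale) enriched \<Rightarrow> ('b, 'q) enriched \<Rightarrow> ('a \<Rightarrow> 'b) \<Rightarrow> ('b \<Rightarrow> 'a) \<Rightarrow> bool"
  where
  "adjunction A B f g \<longleftrightarrow>
     omega_functor A B f \<and> omega_functor B A g \<and>
     (\<forall>a\<in>obj A. \<forall>b\<in>obj B. hom B (f a) b = hom A a (g b))"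

definition left_adjoints ::
  "('a, 'q::comm_unital_quantale) enriched \<Rightarrow> ('b, 'q) enriched \<Rightarrow> ('a \<Rightarrow> 'b, 'q) enriched" where
  "left_adjoints A B =
     \<lparr>obj = {f \<in> obj (functor_category A B). \<exists>g. adjunction A B f g},
      hom = hom (functor_category A B)\<rparr>"

definition is_sup ::
  "('a, 'q::comm_unital_quantale) enriched \<Rightarrow> ('a \<Rightarrow> 'q) \<Rightarrow> 'a \<Rightarrow> bool" where
  "is_sup A \<phi> a \<longleftrightarrow>
     a \<in> obj A \<and> (\<forall>x\<in>obj A. hom A a x = (INF z\<in>obj A. \<phi> z \<rightarrow>\<^sub>q hom A z x))"

text \<open>Only the values of \<open>\<phi>\<close> on \<open>obj A\<close> matter, so \<open>\<phi>\<close> ranges over all total functions.\<close>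

definition complete_omega_lattice :: "('a, 'q::comm_unital_quantale) enriched \<Rightarrow> bool" where
  "complete_omega_lattice A \<longleftrightarrow>
     omega_category A \<and> antisymmetric A \<and> (\<forall>\<phi>. \<exists>a. is_sup A \<phi> a)"

definition sup_map :: "('a, 'q::comm_unital_quantale) enriched \<Rightarrow> ('a \<Rightarrow> 'q) \<Rightarrow> 'a" where
  "sup_map A = (\<lambda>\<phi>\<in>obj (functor_category (dual A) omega). THE a. is_sup A \<phi> a)"

definition completely_distributive :: "('a, 'q::comm_unital_quantale) enriched \<Rightarrow> bool" where
  "completely_distributive A \<longleftrightarrow>
     complete_omega_lattice A \<and>
     (\<exists>l. adjunction A (functor_category (dual A) omega) l (sup_map A))"

end

theory Submission
  imports Defs
begin

text \<open>
  The proof rests on an elementwise description of complete distributivity. In the order-theoretic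
  case a complete lattice is completely distributive iff every element is the join of the
  elements totally below it. Its enriched form is a \<^emph>\<open>distributive basis\<close> of \<open>A\<close>: a family of
  elements \<open>e i\<close> with degrees \<open>w i a \<in> \<Omega>\<close>, to be read as ``\<open>e i\<close> is totally below \<open>a\<close>'', such that
  \<open>w i\<close> refines \<open>A(e i, -)\<close>, commutes with suprema, and such that every \<open>a\<close> is the supremum of the
  \<open>e i\<close> weighted by \<open>w i a\<close>. A complete \<open>\<Omega>\<close>-lattice is completely distributive iff it has a
  distributive basis. In one direction (\<open>completely_distributive_basis\<close>) all elements of \<open>A\<close> form
  a basis, weighted by the left adjoint \<open>l\<close> of \<open>sup\<close>: \<open>w x a = l a x\<close>. In the other direction
  (\<open>basis_completely_distributive\<close>) the left adjoint of \<open>sup\<close> sends \<open>a\<close> to the down-closure of the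
  weights, \<open>x \<mapsto> \<Squnion>\<^sub>i w i a * A(x, e i)\<close>.

  Let \<open>L = [A \<rightarrow>\<^sub>\<ell> B]\<close>. As \<open>A\<close> is complete, \<open>L\<close> consists of the sup-preserving \<open>\<Omega>\<close>-functors, and
  therefore has all suprema, computed pointwise in \<open>B\<close>. If \<open>(e\<^sub>A, w\<^sub>A)\<close> and \<open>(e\<^sub>B, w\<^sub>B)\<close> are bases of
  \<open>A\<close> and \<open>B\<close>, then \<open>L\<close> has a basis indexed by pairs: the step functors
  \<open>a \<mapsto> w\<^sub>A i a \<otimes> e\<^sub>B j\<close>, where \<open>\<otimes>\<close> is the tensor of \<open>B\<close>, weighted by \<open>w\<^sub>B j (f (e\<^sub>A i))\<close>. A step
  functor preserves suprema because \<open>w\<^sub>A i\<close> does; the weights preserve suprema because those of \<open>L\<close>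
  are pointwise and \<open>w\<^sub>B j\<close> preserves them; and every \<open>f\<close> in \<open>L\<close> is the weighted supremum
  of steps, because it preserves the expansion
  \<open>a = \<Squnion>\<^sub>i w\<^sub>A i a \<otimes> e\<^sub>A i\<close>, and each \<open>f (e\<^sub>A i)\<close> can in turn be expanded in \<open>B\<close>
  (\<open>left_adjoints_basis\<close>).

  Equations between homs are mostly handled as equivalences of bounds \<open>c \<le> A(s, x)\<close>,
  since residuals and infima then disappear in favour of products and bounded quantifiers.
\<close>

section \<open>Quantales and weighted colimits\<close>

lemma quantale_mult_mono:
  fixes a :: "'q::comm_unital_quantale"
  assumes "a \<le> b" "c \<le> d"
  shows "a * c \<le> b * d"
proof -
  have right: "u * x \<le> u * y" if "x \<le> y" for u x y :: 'q
    using that by (meson order_refl order_trans residuation)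
  have "a * c \<le> a * d" using assms(2) by (rule right)
  also have "\<dots> \<le> b * d" using right[OF assms(1), of d] by (simp add: mult.commute)
  finally show ?thesis .
qed

lemma quantale_SUP_mult_le_iff:
  fixes c :: "'q::comm_unital_quantale"
  shows "(SUP i\<in>S. f i) * c \<le> d \<longleftrightarrow> (\<forall>i\<in>S. f i * c \<le> d)"
proof -
  have "x * c \<le> d \<longleftrightarrow> x \<le> c \<rightarrow>\<^sub>q d" for x
    by (subst mult.commute) (rule residuation)
  then show ?thesis by (simp add: SUP_le_iff)
qed

text \<open>
  The colimit of \<open>p\<close> weighted by \<open>w\<close>, that is \<open>s = \<Squnion>\<^sub>h w h \<otimes> p h\<close>. A one-element index set gives the
  tensor. Allowing an arbitrary index set avoids transporting every weight to a function on \<open>obj A\<close>.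
\<close>

definition is_colimit ::
  "('a, 'q::comm_unital_quantale) enriched \<Rightarrow> 'i set \<Rightarrow> ('i \<Rightarrow> 'q) \<Rightarrow> ('i \<Rightarrow> 'a) \<Rightarrow> 'a \<Rightarrow> bool" where
  "is_colimit A H w p s \<longleftrightarrow>
     s \<in> obj A \<and> (\<forall>x\<in>obj A. hom A s x = (INF h\<in>H. w h \<rightarrow>\<^sub>q hom A (p h) x))"

lemma is_sup_iff_colimit: "is_sup A \<phi> a \<longleftrightarrow> is_colimit A (obj A) \<phi> (\<lambda>z. z) a"
  by (simp add: is_sup_def is_colimit_def)

lemma eq_iff_same_lower_bounds:
  fixes y z :: "'q::order"
  shows "y = z \<longleftrightarrow> (\<forall>c. c \<le> y \<longleftrightarrow> c \<le> z)"
  by (metis order_antisym order_refl)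

lemma is_colimit_iff:
  fixes A :: "('a, 'q::comm_unital_quantale) enriched"
  shows "is_colimit A H w p s \<longleftrightarrow>
     s \<in> obj A \<and> (\<forall>x\<in>obj A. \<forall>c. c \<le> hom A s x \<longleftrightarrow> (\<forall>h\<in>H. w h * c \<le> hom A (p h) x))"
  by (simp only: is_colimit_def eq_iff_same_lower_bounds[where 'q='q] le_INF_iff residuation)

lemma colimit_obj: "is_colimit A H w p s \<Longrightarrow> s \<in> obj A"
  by (simp add: is_colimit_def)

lemma colimit_le_iff:
  assumes "is_colimit A H w p s" "x \<in> obj A"
  shows "c \<le> hom A s x \<longleftrightarrow> (\<forall>h\<in>H. w h * c \<le> hom A (p h) x)"
  using assms by (simp add: is_colimit_iff)

lemma hom_id: "omega_category A \<Longrightarrow> a \<in> obj A \<Longrightarrow> 1 \<le> hom A a a"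
  by (simp add: omega_category_def)

lemma hom_comp:
  assumes "omega_category A" "a \<in> obj A" "b \<in> obj A" "c \<in> obj A"
    "u \<le> hom A a b" "v \<le> hom A b c"
  shows "u * v \<le> hom A a c"
  using assms(1-4) quantale_mult_mono[OF assms(5,6)] unfolding omega_category_def
  by (meson order_trans)

lemma colimit_upper:
  assumes "omega_category A" "is_colimit A H w p s" "h \<in> H"
  shows "w h \<le> hom A (p h) s"
  using hom_id[OF assms(1) colimit_obj[OF assms(2)]] colimit_le_iff[OF assms(2) colimit_obj[OF assms(2)]]
    assms(3) by fastforce

lemma colimit_unique:
  assumes "omega_category A" "antisymmetric A" "is_colimit A H w p s" "is_colimit A H w p s'"
  shows "s = s'"
proof -
  have "hom A s x = hom A s' x" if "x \<in> obj A" for x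
    using assms(3,4) that by (simp add: is_colimit_def)
  then have "1 \<le> hom A s s'" "1 \<le> hom A s' s"
    using assms(1,3,4) by (metis colimit_obj hom_id)+
  then show ?thesis
    using assms(2-4) unfolding antisymmetric_def by (meson colimit_obj)
qed

text \<open>
  By the Yoneda lemma, mapping out of the weight \<open>w\<close> agrees with mapping out of the presheaf that
  it generates along \<open>p\<close>. Thus suprema already provide all weighted colimits.
\<close>

lemma colimit_is_sup:
  assumes A: "omega_category A" and p: "p ` H \<subseteq> obj A"
  shows "is_sup A (\<lambda>a. SUP h\<in>H. w h * hom A a (p h)) s \<longleftrightarrow> is_colimit A H w p s"
proof -
  have "(\<forall>z\<in>obj A. (SUP h\<in>H. w h * hom A z (p h)) * c \<le> hom A z x) \<longleftrightarrow>
      (\<forall>h\<in>H. w h * c \<le> hom A (p h) x)" (is "?l \<longleftrightarrow> ?r") if x: "x \<in> obj A" for x c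
  proof
    assume l: ?l
    show ?r
    proof
      fix h assume h: "h \<in> H"
      then have ph: "p h \<in> obj A" using p by blast
      then have "w h * hom A (p h) (p h) * c \<le> hom A (p h) x"
        using l h by (simp add: quantale_SUP_mult_le_iff)
      moreover have "w h * 1 * c \<le> w h * hom A (p h) (p h) * c"
        by (intro quantale_mult_mono order_refl hom_id A ph)
      ultimately show "w h * c \<le> hom A (p h) x" by simp
    qed
  next
    assume r: ?r
    show ?l
    proof (clarsimp simp: quantale_SUP_mult_le_iff)
      fix z h assume z: "z \<in> obj A" and h: "h \<in> H"
      then have "p h \<in> obj A" using p by blast
      then have "hom A z (p h) * (w h * c) \<le> hom A z x"
        using A z x h r by (intro hom_comp[of A z "p h" x]) auto
      then show "w h * hom A z (p h) * c \<le> hom A z x" by (simp add: ac_simps)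
    qed
  qed
  then show ?thesis by (simp add: is_sup_iff_colimit is_colimit_iff)
qed

lemma complete_category: "complete_omega_lattice A \<Longrightarrow> omega_category A"
  and complete_antisymmetric: "complete_omega_lattice A \<Longrightarrow> antisymmetric A"
  by (simp_all add: complete_omega_lattice_def)

lemma colimit_exists:
  assumes "complete_omega_lattice A" "p ` H \<subseteq> obj A"
  shows "\<exists>s. is_colimit A H w p s"
  using assms colimit_is_sup[OF complete_category[OF assms(1)] assms(2)]
  unfolding complete_omega_lattice_def by blast

section \<open>Left adjoints preserve and are detected by suprema\<close>

definition preserves_sups ::
  "('a, 'q::comm_unital_quantale) enriched \<Rightarrow> ('b, 'q) enriched \<Rightarrow> ('a \<Rightarrow> 'b) \<Rightarrow> bool" where
  "preserves_sups A B f \<longleftrightarrow> (\<forall>\<phi> s. is_sup A \<phi> s \<longrightarrow> is_colimit B (obj A) \<phi> f (f s))"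

lemma functor_obj: "omega_functor A B f \<Longrightarrow> a \<in> obj A \<Longrightarrow> f a \<in> obj B"
  by (auto simp: omega_functor_def)

lemma functor_hom:
  "omega_functor A B f \<Longrightarrow> a \<in> obj A \<Longrightarrow> a' \<in> obj A \<Longrightarrow> hom A a a' \<le> hom B (f a) (f a')"
  by (auto simp: omega_functor_def)

lemma left_adjoint_preserves_colimits:
  assumes adj: "adjunction A B f g" and p: "p ` H \<subseteq> obj A"
    and s: "is_colimit A H w p s"
  shows "is_colimit B H w (\<lambda>h. f (p h)) (f s)"
proof -
  have f: "omega_functor A B f" and g: "omega_functor B A g"
    and eq: "\<And>a b. a \<in> obj A \<Longrightarrow> b \<in> obj B \<Longrightarrow> hom B (f a) b = hom A a (g b)"
    using adj by (auto simp: adjunction_def)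
  have "hom B (f (p h)) x = hom A (p h) (g x)" if "h \<in> H" "x \<in> obj B" for h x
    using eq p that by blast
  then show ?thesis
    using s by (simp add: is_colimit_iff eq functor_obj[OF f] functor_obj[OF g])
qed

lemma left_adjoint_preserves_sups: "adjunction A B f g \<Longrightarrow> preserves_sups A B f"
  using left_adjoint_preserves_colimits[where p = "\<lambda>z. z"]
  by (fastforce simp: preserves_sups_def is_sup_iff_colimit)

text \<open>
  The adjoint functor theorem: the right adjoint sends \<open>b\<close> to the supremum of all \<open>z\<close>, weighted by
  \<open>B(f z, b)\<close>. Preservation of this supremum by \<open>f\<close> yields the counit.
\<close>

lemma preserves_sups_left_adjoint:
  assumes A: "complete_omega_lattice A" and B: "omega_category B"
    and f: "omega_functor A B f" and pres: "preserves_sups A B f"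
  shows "\<exists>g. adjunction A B f g"
proof -
  note cA = complete_category[OF A]
  define g where "g = (\<lambda>b\<in>obj B. SOME a. is_sup A (\<lambda>z. hom B (f z) b) a)"
  have g_sup: "is_sup A (\<lambda>z. hom B (f z) b) (g b)" if "b \<in> obj B" for b
  proof -
    have "\<exists>a. is_sup A (\<lambda>z. hom B (f z) b) a"
      using A by (simp add: complete_omega_lattice_def)
    from someI_ex[OF this] that show ?thesis by (simp add: g_def)
  qed
  have g_obj: "g b \<in> obj A" if "b \<in> obj B" for b
    using g_sup[OF that] by (simp add: is_sup_def)
  have unit: "hom B (f a) b \<le> hom A a (g b)" if "a \<in> obj A" "b \<in> obj B" for a b
    using colimit_upper[OF cA g_sup[unfolded is_sup_iff_colimit, OF that(2)] that(1)] by simp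
  have counit: "1 \<le> hom B (f (g b)) b" if "b \<in> obj B" for b
    using pres g_sup[OF that] that by (simp add: preserves_sups_def is_colimit_iff)
  have transpose: "hom A a (g b) \<le> hom B (f a) b" if "a \<in> obj A" "b \<in> obj B" for a b
  proof -
    have "hom A a (g b) * 1 \<le> hom B (f a) b"
      using that g_obj f
      by (intro hom_comp[OF B _ _ _ functor_hom[OF f] counit]) (auto simp: functor_obj)
    then show ?thesis by simp
  qed
  have "hom B b b' \<le> hom A (g b) (g b')" if b: "b \<in> obj B" and b': "b' \<in> obj B" for b b'
  proof -
    have "1 * hom B b b' \<le> hom B (f (g b)) b'"
      using b b' g_obj f by (intro hom_comp[OF B _ _ _ counit]) (auto simp: functor_obj)
    with unit[OF g_obj[OF b] b'] show ?thesis by simp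
  qed
  then have "omega_functor B A g"
    using g_obj by (auto simp: omega_functor_def g_def)
  with f unit transpose show ?thesis
    unfolding adjunction_def by (meson order_antisym)
qed

lemma left_adjoints_obj:
  assumes "complete_omega_lattice A" "omega_category B"
  shows "f \<in> obj (left_adjoints A B) \<longleftrightarrow> omega_functor A B f \<and> preserves_sups A B f"
  using assms left_adjoint_preserves_sups preserves_sups_left_adjoint
  by (auto simp: left_adjoints_def functor_category_def)

lemma left_adjoints_hom:
  "hom (left_adjoints A B) f g = (INF x\<in>obj A. hom B (f x) (g x))"
  by (simp add: left_adjoints_def functor_category_def)

lemma left_adjoints_functor: "f \<in> obj (left_adjoints A B) \<Longrightarrow> omega_functor A B f"
  by (simp add: left_adjoints_def functor_category_def)

lemma left_adjoints_value: "f \<in> obj (left_adjoints A B) \<Longrightarrow> a \<in> obj A \<Longrightarrow> f a \<in> obj B"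
  by (rule functor_obj[OF left_adjoints_functor])

section \<open>Distributive bases\<close>

text \<open>
  For the two-element quantale, \<open>w i a\<close> says that \<open>e i\<close> is totally below \<open>a\<close>. The generators
  \<open>e i\<close> may be fewer than all elements of \<open>A\<close>: in a category of left adjoints they will be the step
  functors only.
\<close>

locale distributive_basis =
  fixes A :: "('a, 'q::comm_unital_quantale) enriched"
    and I :: "'i set" and e :: "'i \<Rightarrow> 'a" and w :: "'i \<Rightarrow> 'a \<Rightarrow> 'q"
  assumes basis_obj: "i \<in> I \<Longrightarrow> e i \<in> obj A"
    and below: "\<lbrakk>i \<in> I; a \<in> obj A\<rbrakk> \<Longrightarrow> w i a \<le> hom A (e i) a"
    and weight_functorial: "\<lbrakk>i \<in> I; a \<in> obj A; b \<in> obj A\<rbrakk> \<Longrightarrow> w i a * hom A a b \<le> w i b"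
    and prime: "\<lbrakk>i \<in> I; is_sup A \<phi> s\<rbrakk> \<Longrightarrow> w i s \<le> (SUP z\<in>obj A. \<phi> z * w i z)"
    and dense: "a \<in> obj A \<Longrightarrow> is_colimit A I (\<lambda>i. w i a) e a"
begin

text \<open>
  Applying the defining inequality for suprema to the presheaf generated by \<open>v\<close> along \<open>p\<close> extends
  it to all colimits. The reverse inequality is functoriality of the weight.
\<close>

lemma weight_preserves_colimits:
  assumes A: "omega_category A" and p: "p ` H \<subseteq> obj A"
    and s: "is_colimit A H v p s" and i: "i \<in> I"
  shows "w i s = (SUP h\<in>H. v h * w i (p h))"
proof (rule order_antisym)
  have "w i s \<le> (SUP z\<in>obj A. (SUP h\<in>H. v h * hom A z (p h)) * w i z)"
    using s colimit_is_sup[OF A p] by (intro prime i) blast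
  also have "\<dots> \<le> (SUP h\<in>H. v h * w i (p h))"
  proof (clarsimp simp: SUP_le_iff quantale_SUP_mult_le_iff)
    fix z h assume z: "z \<in> obj A" and h: "h \<in> H"
    then have "p h \<in> obj A" using p by blast
    then have "v h * (w i z * hom A z (p h)) \<le> v h * w i (p h)"
      using z i by (intro quantale_mult_mono order_refl weight_functorial)
    also have "\<dots> \<le> (SUP h\<in>H. v h * w i (p h))" using h by (rule SUP_upper)
    finally show "v h * hom A z (p h) * w i z \<le> (SUP h\<in>H. v h * w i (p h))"
      by (simp add: ac_simps)
  qed
  finally show "w i s \<le> (SUP h\<in>H. v h * w i (p h))" .
next
  show "(SUP h\<in>H. v h * w i (p h)) \<le> w i s"
  proof (rule SUP_least)
    fix h assume h: "h \<in> H"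
    then have "p h \<in> obj A" using p by blast
    then have "w i (p h) * v h \<le> w i (p h) * hom A (p h) s"
      using colimit_upper[OF A s h] by (intro quantale_mult_mono order_refl)
    also have "\<dots> \<le> w i s"
      using i \<open>p h \<in> obj A\<close> colimit_obj[OF s] by (rule weight_functorial)
    finally show "v h * w i (p h) \<le> w i s" by (simp add: ac_simps)
  qed
qed

end

lemma presheaf_iff:
  "\<phi> \<in> obj (functor_category (dual A) omega) \<longleftrightarrow>
     \<phi> \<in> extensional (obj A) \<and> (\<forall>a\<in>obj A. \<forall>b\<in>obj A. \<phi> a * hom A b a \<le> \<phi> b)"
  by (auto simp: functor_category_def omega_functor_def dual_def omega_def residuation PiE_def)

lemma presheaf_hom_le_iff:
  "c \<le> hom (functor_category (dual A) omega) \<phi> \<psi> \<longleftrightarrow> (\<forall>x\<in>obj A. \<phi> x * c \<le> \<psi> x)"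
  by (simp add: functor_category_def dual_def omega_def residuation le_INF_iff)

lemma sup_map_is_sup:
  assumes A: "complete_omega_lattice A" and "\<phi> \<in> obj (functor_category (dual A) omega)"
  shows "is_sup A \<phi> (sup_map A \<phi>)"
proof -
  have "\<exists>!a. is_sup A \<phi> a"
    using A colimit_unique[OF complete_category[OF A] complete_antisymmetric[OF A]]
    unfolding complete_omega_lattice_def is_sup_iff_colimit by metis
  from theI'[OF this] assms(2) show ?thesis by (simp add: sup_map_def)
qed

text \<open>
  The weight is the left adjoint \<open>l\<close> of \<open>sup\<close>, and each basis axiom is obtained by comparing
  \<open>l a\<close> with a suitable presheaf: with \<open>A(-, a)\<close> to bound \<open>l a\<close> by the hom, with
  \<open>x \<mapsto> \<Squnion>\<^sub>z \<phi> z * l z x\<close> for primeness, and with \<open>l a\<close> itself for density.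
\<close>

lemma completely_distributive_basis:
  assumes cd: "completely_distributive A"
  shows "\<exists>t. distributive_basis A (obj A) (\<lambda>x. x) t"
proof -
  let ?P = "functor_category (dual A) omega"
  have co: "complete_omega_lattice A" using cd by (simp add: completely_distributive_def)
  note A = complete_category[OF co]
  obtain l where l: "adjunction A ?P l (sup_map A)"
    using cd by (auto simp: completely_distributive_def)
  have fun_l: "omega_functor A ?P l" using l by (simp add: adjunction_def)
  have l_obj: "l a \<in> obj ?P" if "a \<in> obj A" for a using functor_obj[OF fun_l that] .
  have adj: "c \<le> hom A a s \<longleftrightarrow> (\<forall>x\<in>obj A. l a x * c \<le> \<psi> x)"
    if "a \<in> obj A" and psi: "\<psi> \<in> obj ?P" and s: "is_sup A \<psi> s" for c a \<psi> s
  proof -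
    have "s = sup_map A \<psi>"
      using colimit_unique[OF A complete_antisymmetric[OF co]] s sup_map_is_sup[OF co psi]
      unfolding is_sup_iff_colimit by blast
    then have "hom A a s = hom ?P (l a) \<psi>"
      using l that by (simp add: adjunction_def)
    then show ?thesis by (simp add: presheaf_hom_le_iff)
  qed
  have below: "l a x \<le> hom A x a" if x: "x \<in> obj A" and a: "a \<in> obj A" for a x
  proof -
    let ?y = "restrict (\<lambda>x. hom A x a) (obj A)"
    have "hom A x a * hom A z x \<le> hom A z a" if "x \<in> obj A" "z \<in> obj A" for x z
      by (subst mult.commute) (rule hom_comp[OF A that(2,1) a order_refl order_refl])
    then have "?y \<in> obj ?P" by (simp add: presheaf_iff)
    moreover have "is_sup A ?y a"
    proof -
      have "is_colimit A {()} (\<lambda>_. 1) (\<lambda>_. a) a"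
        using a by (simp add: is_colimit_iff)
      then have "is_sup A (\<lambda>x. hom A x a) a"
        using a by (subst (asm) colimit_is_sup[symmetric, OF A]) auto
      then show ?thesis by (simp add: is_sup_def)
    qed
    ultimately have "l a x * 1 \<le> ?y x"
      using adj[of a ?y a 1] hom_id[OF A a] a x by blast
    with x show ?thesis by simp
  qed
  have weight: "l a x * hom A a b \<le> l b x" if "x \<in> obj A" "a \<in> obj A" "b \<in> obj A" for x a b
    using functor_hom[OF fun_l that(2,3)] that(1) by (simp add: presheaf_hom_le_iff)
  have prime: "l s x \<le> (SUP z\<in>obj A. \<phi> z * l z x)" if x: "x \<in> obj A" and s: "is_sup A \<phi> s" for \<phi> s x
  proof -
    let ?\<psi> = "restrict (\<lambda>x. SUP z\<in>obj A. \<phi> z * l z x) (obj A)"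
    have psi: "?\<psi> \<in> obj ?P"
    proof (clarsimp simp: presheaf_iff quantale_SUP_mult_le_iff)
      fix a b z assume abz: "a \<in> obj A" "b \<in> obj A" "z \<in> obj A"
      then have "\<phi> z * (l z a * hom A b a) \<le> \<phi> z * l z b"
        using l_obj[of z] by (intro quantale_mult_mono order_refl) (simp add: presheaf_iff)
      also have "\<dots> \<le> (SUP z\<in>obj A. \<phi> z * l z b)" using abz by (intro SUP_upper)
      finally show "\<phi> z * l z a * hom A b a \<le> (SUP z\<in>obj A. \<phi> z * l z b)" by (simp add: ac_simps)
    qed
    obtain r where r: "is_sup A ?\<psi> r" using co unfolding complete_omega_lattice_def by blast
    have r_obj: "r \<in> obj A" and s_obj: "s \<in> obj A" using r s by (simp_all add: is_sup_def)
    \<comment> \<open>The supremum of the comparison presheaf bounds the family weighted by \<open>\<phi>\<close>, hence it bounds \<open>s\<close>.\<close>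
    have "\<phi> z \<le> hom A z r" if "z \<in> obj A" for z
      using that by (auto simp: adj[OF that psi r] mult.commute intro!: SUP_upper)
    then have "1 \<le> hom A s r"
      using s r_obj by (simp add: is_sup_iff_colimit is_colimit_iff)
    then show ?thesis using adj[OF s_obj psi r, of 1] x by simp
  qed
  have dense: "is_colimit A (obj A) (\<lambda>x. l a x) (\<lambda>x. x) a" if a: "a \<in> obj A" for a
  proof -
    obtain s where s: "is_sup A (l a) s" using co unfolding complete_omega_lattice_def by blast
    then have s_obj: "s \<in> obj A" by (simp add: is_sup_def)
    have "1 \<le> hom A a s" using adj[OF a l_obj[OF a] s, of 1] by simp
    moreover have "1 \<le> hom A s a"
      using s a below by (simp add: is_sup_iff_colimit is_colimit_iff)
    ultimately have "a = s"
      using complete_antisymmetric[OF co] a s_obj by (simp add: antisymmetric_def)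
    with s show ?thesis by (simp add: is_sup_iff_colimit)
  qed
  have "distributive_basis A (obj A) (\<lambda>x. x) (\<lambda>x a. l a x)"
    using below weight prime dense by unfold_locales auto
  then show ?thesis by blast
qed

text \<open>
  Mapping out of the presheaf generated by the weights \<open>w i a\<close> at the points \<open>e i\<close> means bounding
  \<open>w i a * c\<close> by \<open>\<phi> (e i)\<close> (Yoneda). Density gives \<open>c \<le> A(a, sup \<phi>)\<close> from such bounds;
  conversely, primeness spreads \<open>w i (sup \<phi>)\<close> over the members of \<open>\<phi>\<close>, where \<open>below\<close> applies and
  \<open>\<phi>\<close> is down-closed.
\<close>

lemma basis_completely_distributive:
  assumes co: "complete_omega_lattice A" and basis: "distributive_basis A I e w"
  shows "completely_distributive A"
proof -
  interpret distributive_basis A I e w by (rule basis)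
  let ?P = "functor_category (dual A) omega"
  note A = complete_category[OF co]
  define l where "l = (\<lambda>a\<in>obj A. \<lambda>x\<in>obj A. SUP i\<in>I. w i a * hom A x (e i))"
  have l_obj: "l a \<in> obj ?P" if a: "a \<in> obj A" for a
  proof (clarsimp simp: presheaf_iff l_def a quantale_SUP_mult_le_iff)
    fix x y i assume xyi: "x \<in> obj A" "y \<in> obj A" "i \<in> I"
    then have "w i a * (hom A y x * hom A x (e i)) \<le> w i a * hom A y (e i)"
      by (intro quantale_mult_mono hom_comp[OF A, of y x "e i"] basis_obj) simp_all
    also have "\<dots> \<le> (SUP i\<in>I. w i a * hom A y (e i))" using xyi by (intro SUP_upper)
    finally show "w i a * hom A x (e i) * hom A y x \<le> (SUP i\<in>I. w i a * hom A y (e i))"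
      by (simp add: ac_simps)
  qed
  have yoneda: "c \<le> hom ?P (l a) \<phi> \<longleftrightarrow> (\<forall>i\<in>I. w i a * c \<le> \<phi> (e i))"
    if a: "a \<in> obj A" and phi: "\<phi> \<in> obj ?P" for c a \<phi>
  proof
    assume c: "c \<le> hom ?P (l a) \<phi>"
    show "\<forall>i\<in>I. w i a * c \<le> \<phi> (e i)"
    proof
      fix i assume i: "i \<in> I"
      have "w i a * 1 * c \<le> w i a * hom A (e i) (e i) * c"
        using i by (intro quantale_mult_mono order_refl hom_id A basis_obj)
      also have "\<dots> \<le> \<phi> (e i)"
        using c i a basis_obj[OF i]
        by (auto simp: presheaf_hom_le_iff l_def quantale_SUP_mult_le_iff)
      finally show "w i a * c \<le> \<phi> (e i)" by simp
    qed
  next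
    assume c: "\<forall>i\<in>I. w i a * c \<le> \<phi> (e i)"
    have "w i a * hom A x (e i) * c \<le> \<phi> x" if i: "i \<in> I" and x: "x \<in> obj A" for i x
    proof -
      have "w i a * c * hom A x (e i) \<le> \<phi> (e i) * hom A x (e i)"
        using c i by (intro quantale_mult_mono order_refl) auto
      also have "\<dots> \<le> \<phi> x" using phi i x basis_obj by (simp add: presheaf_iff)
      finally show ?thesis by (simp add: ac_simps)
    qed
    then show "c \<le> hom ?P (l a) \<phi>"
      using a by (simp add: presheaf_hom_le_iff l_def quantale_SUP_mult_le_iff)
  qed
  have sup: "is_sup A \<phi> (sup_map A \<phi>)" if "\<phi> \<in> obj ?P" for \<phi>
    using sup_map_is_sup[OF co that] .
  have sup_obj: "sup_map A \<phi> \<in> obj A" if "\<phi> \<in> obj ?P" for \<phi>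
    using sup[OF that] by (simp add: is_sup_def)
  have sup_upper: "\<phi> x \<le> hom A x (sup_map A \<phi>)" if "\<phi> \<in> obj ?P" "x \<in> obj A" for \<phi> x
    using colimit_upper[OF A sup[OF that(1), unfolded is_sup_iff_colimit] that(2)] .
  have adj: "hom ?P (l a) \<phi> = hom A a (sup_map A \<phi>)" if a: "a \<in> obj A" and phi: "\<phi> \<in> obj ?P" for a \<phi>
  proof -
    let ?s = "sup_map A \<phi>"
    have "(\<forall>i\<in>I. w i a * c \<le> \<phi> (e i)) \<longleftrightarrow> c \<le> hom A a ?s" for c
    proof
      assume c: "\<forall>i\<in>I. w i a * c \<le> \<phi> (e i)"
      have "w i a * c \<le> hom A (e i) ?s" if "i \<in> I" for i
        using c that sup_upper[OF phi basis_obj[OF that]] by (meson order_trans)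
      then show "c \<le> hom A a ?s"
        using colimit_le_iff[OF dense[OF a] sup_obj[OF phi]] by blast
    next
      assume c: "c \<le> hom A a ?s"
      show "\<forall>i\<in>I. w i a * c \<le> \<phi> (e i)"
      proof
        fix i assume i: "i \<in> I"
        have "w i a * c \<le> w i a * hom A a ?s" using c by (intro quantale_mult_mono order_refl)
        also have "\<dots> \<le> w i ?s" using i a sup_obj[OF phi] by (rule weight_functorial)
        also have "\<dots> \<le> (SUP z\<in>obj A. \<phi> z * w i z)" using i sup[OF phi] by (rule prime)
        also have "\<dots> \<le> \<phi> (e i)"
        proof (rule SUP_least)
          fix z assume z: "z \<in> obj A"
          have "\<phi> z * w i z \<le> \<phi> z * hom A (e i) z"
            using i z by (intro quantale_mult_mono order_refl below)
          also have "\<dots> \<le> \<phi> (e i)" using phi z basis_obj[OF i] by (simp add: presheaf_iff)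
          finally show "\<phi> z * w i z \<le> \<phi> (e i)" .
        qed
        finally show "w i a * c \<le> \<phi> (e i)" .
      qed
    qed
    then show ?thesis by (simp add: eq_iff_same_lower_bounds[of "hom ?P (l a) \<phi>"] yoneda[OF a phi])
  qed
  have "omega_functor ?P A (sup_map A)"
  proof -
    have "hom ?P \<phi> \<psi> \<le> hom A (sup_map A \<phi>) (sup_map A \<psi>)"
      if phi: "\<phi> \<in> obj ?P" and psi: "\<psi> \<in> obj ?P" for \<phi> \<psi>
    proof -
      have "\<phi> z * hom ?P \<phi> \<psi> \<le> \<psi> z" if "z \<in> obj A" for z
        using presheaf_hom_le_iff[of "hom ?P \<phi> \<psi>" A \<phi> \<psi>] that by simp
      then show ?thesis
        using colimit_le_iff[OF sup[OF phi, unfolded is_sup_iff_colimit] sup_obj[OF psi]]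
          sup_upper[OF psi] by (meson order_trans)
    qed
    then show ?thesis using sup_obj by (auto simp: omega_functor_def sup_map_def)
  qed
  moreover have "omega_functor A ?P l"
  proof -
    have "hom A a b \<le> hom ?P (l a) (l b)" if a: "a \<in> obj A" and b: "b \<in> obj A" for a b
    proof -
      have "1 \<le> hom ?P (l b) (l b)" by (simp add: presheaf_hom_le_iff)
      then have "1 \<le> hom A b (sup_map A (l b))" using adj[OF b l_obj[OF b]] by simp
      then have "hom A a b * 1 \<le> hom A a (sup_map A (l b))"
        using a b sup_obj[OF l_obj[OF b]] by (intro hom_comp[OF A, of a b]) simp_all
      then show ?thesis using adj[OF a l_obj[OF b]] by simp
    qed
    then show ?thesis using l_obj by (auto simp: omega_functor_def l_def)
  qed
  ultimately have "adjunction A ?P l (sup_map A)"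
    using adj by (simp add: adjunction_def)
  with co show ?thesis by (auto simp: completely_distributive_def)
qed

section \<open>The lattice of left adjoints\<close>

lemma left_adjoints_category:
  assumes B: "omega_category B"
  shows "omega_category (left_adjoints A B)"
proof -
  let ?L = "left_adjoints A B"
  have obj: "f x \<in> obj B" if "f \<in> obj ?L" "x \<in> obj A" for f x
    using that by (rule left_adjoints_value)
  have le: "hom ?L f g \<le> hom B (f x) (g x)" if "x \<in> obj A" for f g x
    using that by (auto simp: left_adjoints_hom intro: INF_lower)
  show ?thesis
    unfolding omega_category_def
  proof (intro conjI ballI)
    fix f assume f: "f \<in> obj ?L"
    show "1 \<le> hom ?L f f"
      unfolding left_adjoints_hom le_INF_iff using obj[OF f] hom_id[OF B] by blast
  next
    fix f g h assume f: "f \<in> obj ?L" and g: "g \<in> obj ?L" and h: "h \<in> obj ?L"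
    have "hom ?L f g * hom ?L g h \<le> hom B (f x) (h x)" if x: "x \<in> obj A" for x
      using obj[OF f x] obj[OF g x] obj[OF h x] le[OF x] le[OF x] by (rule hom_comp[OF B])
    then show "hom ?L f g * hom ?L g h \<le> hom ?L f h"
      unfolding left_adjoints_hom[of A B f h] le_INF_iff by blast
  qed
qed

lemma left_adjoints_antisymmetric:
  assumes anti: "antisymmetric B"
  shows "antisymmetric (left_adjoints A B)"
  unfolding antisymmetric_def
proof (intro ballI impI)
  fix f g assume f: "f \<in> obj (left_adjoints A B)" and g: "g \<in> obj (left_adjoints A B)"
    and fg: "1 \<le> hom (left_adjoints A B) f g" and gf: "1 \<le> hom (left_adjoints A B) g f"
  have ff: "omega_functor A B f" and gg: "omega_functor A B g"
    using f g by (simp_all add: left_adjoints_functor)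
  show "f = g"
  proof (rule PiE_ext)
    show "f \<in> obj A \<rightarrow>\<^sub>E obj B" "g \<in> obj A \<rightarrow>\<^sub>E obj B"
      using ff gg by (simp_all add: omega_functor_def)
    fix x assume x: "x \<in> obj A"
    then have "1 \<le> hom B (f x) (g x)" "1 \<le> hom B (g x) (f x)"
      using fg gf by (simp_all add: left_adjoints_hom le_INF_iff)
    then show "f x = g x"
      using anti functor_obj[OF ff x] functor_obj[OF gg x] by (simp add: antisymmetric_def)
  qed
qed

text \<open>
  Colimits commute with colimits: a pointwise colimit of sup-preserving functors preserves suprema,
  so it remains among the left adjoints.
\<close>

lemma pointwise_colimit:
  assumes A: "complete_omega_lattice A" and B: "omega_category B"
    and p: "p ` H \<subseteq> obj (left_adjoints A B)"
    and s_ext: "s \<in> extensional (obj A)"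
    and s: "\<And>a. a \<in> obj A \<Longrightarrow> is_colimit B H v (\<lambda>h. p h a) (s a)"
  shows "is_colimit (left_adjoints A B) H v p s"
proof -
  let ?L = "left_adjoints A B"
  have p_fun: "omega_functor A B (p h)" and p_pres: "preserves_sups A B (p h)" if "h \<in> H" for h
  proof -
    have "p h \<in> obj ?L" using p that by blast
    then show "omega_functor A B (p h)" "preserves_sups A B (p h)"
      by (simp_all add: left_adjoints_obj[OF A B])
  qed
  have s_obj: "s a \<in> obj B" if "a \<in> obj A" for a using colimit_obj[OF s[OF that]] .
  have "hom A a b \<le> hom B (s a) (s b)" if a: "a \<in> obj A" and b: "b \<in> obj A" for a b
  proof -
    have "hom A a b * v h \<le> hom B (p h a) (s b)" if h: "h \<in> H" for h
      using a b s_obj p_fun[OF h] functor_hom[OF p_fun[OF h]] colimit_upper[OF B s[OF b] h]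
      by (intro hom_comp[OF B, of _ "p h b"]) (auto simp: functor_obj)
    then show ?thesis
      by (simp add: colimit_le_iff[OF s[OF a] s_obj[OF b]] mult.commute)
  qed
  then have "omega_functor A B s"
    using s_ext s_obj by (auto simp: omega_functor_def PiE_def)
  moreover have "preserves_sups A B s"
    unfolding preserves_sups_def
  proof (intro allI impI)
    fix \<phi> r assume r: "is_sup A \<phi> r"
    then have r_obj: "r \<in> obj A" by (simp add: is_sup_def)
    have "c \<le> hom B (s r) y \<longleftrightarrow> (\<forall>z\<in>obj A. \<phi> z * c \<le> hom B (s z) y)" if y: "y \<in> obj B" for c y
    proof -
      have "v h * c \<le> hom B (p h r) y \<longleftrightarrow> (\<forall>z\<in>obj A. v h * (\<phi> z * c) \<le> hom B (p h z) y)"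
        if "h \<in> H" for h
        using p_pres[OF that] r y
        by (simp add: preserves_sups_def is_colimit_iff mult.left_commute)
      then show ?thesis
        using y r_obj by (auto simp: colimit_le_iff[OF s])
    qed
    then show "is_colimit B (obj A) \<phi> s (s r)"
      using s_obj[OF r_obj] by (simp add: is_colimit_iff)
  qed
  ultimately have "s \<in> obj ?L" by (simp add: left_adjoints_obj[OF A B])
  moreover have "c \<le> hom ?L s k \<longleftrightarrow> (\<forall>h\<in>H. v h * c \<le> hom ?L (p h) k)" if k: "k \<in> obj ?L" for c k
  proof -
    have "k x \<in> obj B" if "x \<in> obj A" for x
      using k that by (rule left_adjoints_value)
    then show ?thesis
      by (auto simp: left_adjoints_hom le_INF_iff colimit_le_iff[OF s])
  qed
  ultimately show ?thesis by (simp add: is_colimit_iff)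
qed

lemma left_adjoints_colimit_exists:
  assumes A: "complete_omega_lattice A" and B: "complete_omega_lattice B"
    and p: "p ` H \<subseteq> obj (left_adjoints A B)"
  shows "\<exists>s. is_colimit (left_adjoints A B) H v p s \<and>
     (\<forall>a\<in>obj A. is_colimit B H v (\<lambda>h. p h a) (s a))"
proof -
  note cB = complete_category[OF B]
  have "\<exists>r. is_colimit B H v (\<lambda>h. p h a) r" if "a \<in> obj A" for a
    using that p by (intro colimit_exists[OF B]) (auto intro: left_adjoints_value)
  then obtain s0 where s0: "\<And>a. a \<in> obj A \<Longrightarrow> is_colimit B H v (\<lambda>h. p h a) (s0 a)"
    by metis
  let ?s = "restrict s0 (obj A)"
  have "is_colimit (left_adjoints A B) H v p ?s"
    using s0 by (intro pointwise_colimit[OF A cB p]) auto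
  with s0 show ?thesis by (intro exI[of _ ?s]) auto
qed

lemma left_adjoints_complete:
  assumes A: "complete_omega_lattice A" and B: "complete_omega_lattice B"
  shows "complete_omega_lattice (left_adjoints A B)"
proof -
  have "\<exists>s. is_sup (left_adjoints A B) \<phi> s" for \<phi>
    unfolding is_sup_iff_colimit
    using left_adjoints_colimit_exists[OF A B, of "\<lambda>z. z" "obj (left_adjoints A B)" \<phi>] by auto
  then show ?thesis
    unfolding complete_omega_lattice_def
    by (intro conjI allI left_adjoints_category[OF complete_category[OF B]]
      left_adjoints_antisymmetric[OF complete_antisymmetric[OF B]])
qed

lemma left_adjoints_colimit_pointwise:
  assumes A: "complete_omega_lattice A" and B: "complete_omega_lattice B"
    and p: "p ` H \<subseteq> obj (left_adjoints A B)"
    and s: "is_colimit (left_adjoints A B) H v p s" and a: "a \<in> obj A"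
  shows "is_colimit B H v (\<lambda>h. p h a) (s a)"
proof -
  note L = left_adjoints_complete[OF A B]
  obtain s' where colim: "is_colimit (left_adjoints A B) H v p s'"
    and s': "\<forall>a\<in>obj A. is_colimit B H v (\<lambda>h. p h a) (s' a)"
    using left_adjoints_colimit_exists[OF A B p] by blast
  have "s = s'"
    using complete_category[OF L] complete_antisymmetric[OF L] s colim by (rule colimit_unique)
  with s' a show ?thesis by blast
qed

text \<open>
  The step functor is \<open>a \<mapsto> wA i a \<otimes> b\<close>. It preserves suprema because the weight \<open>wA i\<close> does and
  \<open>- \<otimes> b\<close> is a left adjoint; the stated equivalence is the universal property of the tensor.
\<close>

lemma step_functor_exists:
  assumes A: "complete_omega_lattice A" and B: "complete_omega_lattice B"
    and basis: "distributive_basis A I eA wA" and i: "i \<in> I" and b: "b \<in> obj B"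
  shows "\<exists>e\<in>obj (left_adjoints A B). \<forall>a\<in>obj A. \<forall>y\<in>obj B. \<forall>c.
           c \<le> hom B (e a) y \<longleftrightarrow> wA i a * c \<le> hom B b y"
proof -
  interpret A: distributive_basis A I eA wA by (rule basis)
  note cA = complete_category[OF A] and cB = complete_category[OF B]
  have "\<exists>r. is_colimit B {()} (\<lambda>_. wA i a) (\<lambda>_. b) r" for a
    using b by (intro colimit_exists[OF B]) simp
  then obtain e0 where e0: "\<And>a. is_colimit B {()} (\<lambda>_. wA i a) (\<lambda>_. b) (e0 a)" by metis
  define e where "e = restrict e0 (obj A)"
  have e_obj: "e a \<in> obj B" if "a \<in> obj A" for a
    using colimit_obj[OF e0] that by (simp add: e_def)
  have e_le: "c \<le> hom B (e a) y \<longleftrightarrow> wA i a * c \<le> hom B b y"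
    if "a \<in> obj A" "y \<in> obj B" for a y c
    using colimit_le_iff[OF e0 that(2)] that(1) by (simp add: e_def)
  have e_upper: "wA i a \<le> hom B b (e a)" if "a \<in> obj A" for a
    using colimit_upper[OF cB e0, of "()" a] that by (simp add: e_def)
  have "omega_functor A B e"
  proof -
    have "hom A a a' \<le> hom B (e a) (e a')" if a: "a \<in> obj A" and a': "a' \<in> obj A" for a a'
      using A.weight_functorial[OF i a a'] e_upper[OF a'] e_le[OF a e_obj[OF a']]
      by (meson order_trans)
    then show ?thesis using e_obj by (auto simp: omega_functor_def e_def)
  qed
  moreover have "preserves_sups A B e"
    unfolding preserves_sups_def
  proof (intro allI impI)
    fix \<phi> s assume s: "is_sup A \<phi> s"
    then have s_obj: "s \<in> obj A" by (simp add: is_sup_def)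
    have "wA i s = (SUP z\<in>obj A. \<phi> z * wA i z)"
      using A.weight_preserves_colimits[OF cA _ s[unfolded is_sup_iff_colimit] i] by simp
    then have "c \<le> hom B (e s) y \<longleftrightarrow> (\<forall>z\<in>obj A. \<phi> z * c \<le> hom B (e z) y)" if "y \<in> obj B" for c y
      using that s_obj by (simp add: e_le quantale_SUP_mult_le_iff mult.assoc mult.left_commute)
    then show "is_colimit B (obj A) \<phi> e (e s)"
      using e_obj[OF s_obj] by (simp add: is_colimit_iff)
  qed
  ultimately show ?thesis
    using e_le by (intro bexI[of _ e]) (simp_all add: left_adjoints_obj[OF A cB])
qed

text \<open>
  The steps form a basis because the value of a left adjoint \<open>f\<close> at \<open>a\<close> is
  \<open>\<Squnion>\<^sub>i wA i a \<otimes> f (eA i) = \<Squnion>\<^sub>i\<^sub>j wA i a \<otimes> wB j (f (eA i)) \<otimes> eB j\<close>.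
\<close>

lemma left_adjoints_basis:
  assumes A: "complete_omega_lattice A" and B: "complete_omega_lattice B"
    and basis_A: "distributive_basis A I eA wA" and basis_B: "distributive_basis B J eB wB"
  shows "\<exists>e. distributive_basis (left_adjoints A B) (I \<times> J) e (\<lambda>(i, j) f. wB j (f (eA i)))"
proof -
  interpret A: distributive_basis A I eA wA by (rule basis_A)
  interpret B: distributive_basis B J eB wB by (rule basis_B)
  let ?L = "left_adjoints A B"
  note cB = complete_category[OF B]
  note L_fun = left_adjoints_functor[of _ A B] and L_obj = left_adjoints_value[of _ A B]
  have "\<forall>q\<in>I \<times> J. \<exists>e\<in>obj ?L. \<forall>a\<in>obj A. \<forall>y\<in>obj B. \<forall>c.
      c \<le> hom B (e a) y \<longleftrightarrow> wA (fst q) a * c \<le> hom B (eB (snd q)) y"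
    using step_functor_exists[OF A B basis_A] B.basis_obj by auto
  then obtain e where "\<forall>q\<in>I \<times> J. e q \<in> obj ?L \<and> (\<forall>a\<in>obj A. \<forall>y\<in>obj B. \<forall>c.
      c \<le> hom B (e q a) y \<longleftrightarrow> wA (fst q) a * c \<le> hom B (eB (snd q)) y)"
    by metis
  then have e_obj: "e (i, j) \<in> obj ?L"
    and e_le: "\<lbrakk>a \<in> obj A; y \<in> obj B\<rbrakk> \<Longrightarrow>
      c \<le> hom B (e (i, j) a) y \<longleftrightarrow> wA i a * c \<le> hom B (eB j) y"
    if "i \<in> I" "j \<in> J" for i j a y c
    using that by auto
  have "distributive_basis ?L (I \<times> J) e (\<lambda>(i, j) f. wB j (f (eA i)))"
  proof (unfold_locales; clarify?; (unfold prod.case)?)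
    fix i j assume i: "i \<in> I" and j: "j \<in> J"
    show "e (i, j) \<in> obj ?L" using e_obj[OF i j] .
    note x = A.basis_obj[OF i]
    {
      fix f assume f: "f \<in> obj ?L"
      \<comment> \<open>The step lies below \<open>f\<close> to degree \<open>wB j (f (eA i))\<close> by the path \<open>eB j\<close>, \<open>f (eA i)\<close>, \<open>f a\<close>.\<close>
      have "wA i a * wB j (f (eA i)) \<le> hom B (eB j) (f a)" if a: "a \<in> obj A" for a
      proof -
        have "wB j (f (eA i)) * hom A (eA i) a \<le> hom B (eB j) (f a)"
          using B.basis_obj[OF j] L_obj[OF f] x a B.below[OF j] functor_hom[OF L_fun[OF f]]
          by (intro hom_comp[OF cB, of _ "f (eA i)"]) auto
        moreover have "wB j (f (eA i)) * wA i a \<le> wB j (f (eA i)) * hom A (eA i) a"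
          using A.below[OF i a] by (intro quantale_mult_mono order_refl)
        ultimately show ?thesis by (metis mult.commute order_trans)
      qed
      then show "wB j (f (eA i)) \<le> hom ?L (e (i, j)) f"
        using L_obj[OF f] by (simp add: left_adjoints_hom le_INF_iff e_le[OF i j])
      fix g assume g: "g \<in> obj ?L"
      have "wB j (f (eA i)) * hom ?L f g \<le> wB j (f (eA i)) * hom B (f (eA i)) (g (eA i))"
        using x by (intro quantale_mult_mono order_refl) (auto simp: left_adjoints_hom intro: INF_lower)
      also have "\<dots> \<le> wB j (g (eA i))"
        using L_obj f g x by (intro B.weight_functorial[OF j])
      finally show "wB j (f (eA i)) * hom ?L f g \<le> wB j (g (eA i))" .
    next
      fix \<phi> s assume s: "is_sup ?L \<phi> s"
      have "is_colimit B (obj ?L) \<phi> (\<lambda>h. h (eA i)) (s (eA i))"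
        using left_adjoints_colimit_pointwise[OF A B _ s[unfolded is_sup_iff_colimit] x] by simp
      then show "wB j (s (eA i)) \<le> (SUP z\<in>obj ?L. \<phi> z * wB j (z (eA i)))"
        using L_obj x by (subst B.weight_preserves_colimits[OF cB _ _ j]) auto
    }
  next
    fix f assume f: "f \<in> obj ?L"
    have "c \<le> hom B (f a) y \<longleftrightarrow>
        (\<forall>i\<in>I. \<forall>j\<in>J. wB j (f (eA i)) * c \<le> hom B (e (i, j) a) y)"
      if a: "a \<in> obj A" and y: "y \<in> obj B" for a y c
    proof -
      obtain g where "adjunction A B f g"
        using f by (auto simp: left_adjoints_def)
      then have "is_colimit B I (\<lambda>i. wA i a) (\<lambda>i. f (eA i)) (f a)"
        using A.basis_obj A.dense[OF a] left_adjoint_preserves_colimits[of A B f g eA I]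
        by (simp add: image_subset_iff)
      then have "c \<le> hom B (f a) y \<longleftrightarrow> (\<forall>i\<in>I. wA i a * c \<le> hom B (f (eA i)) y)"
        using y by (rule colimit_le_iff)
      also have "\<dots> \<longleftrightarrow> (\<forall>i\<in>I. \<forall>j\<in>J. wB j (f (eA i)) * (wA i a * c) \<le> hom B (eB j) y)"
        using y colimit_le_iff[OF B.dense[OF L_obj[OF f A.basis_obj]]] by simp
      also have "\<dots> \<longleftrightarrow> (\<forall>i\<in>I. \<forall>j\<in>J. wB j (f (eA i)) * c \<le> hom B (e (i, j) a) y)"
        using a y by (simp add: e_le mult.left_commute)
      finally show ?thesis .
    qed
    then have "c \<le> hom ?L f k \<longleftrightarrow>
        (\<forall>q\<in>I \<times> J. (case q of (i, j) \<Rightarrow> wB j (f (eA i))) * c \<le> hom ?L (e q) k)"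
      if k: "k \<in> obj ?L" for c k
      using L_obj[OF k] by (auto simp: left_adjoints_hom le_INF_iff)
    then show "is_colimit ?L (I \<times> J) (\<lambda>q. (case q of (i, j) \<Rightarrow> (\<lambda>f. wB j (f (eA i)))) f) e f"
      using f by (simp add: is_colimit_iff split_beta)
  qed
  then show ?thesis by blast
qed

theorem theorem6p3:
  fixes A :: "('a, 'q::comm_unital_quantale) enriched"
    and B :: "('b, 'q) enriched"
  assumes "completely_distributive A"
    and "completely_distributive B"
  shows "completely_distributive (left_adjoints A B)"
proof -
  have A: "complete_omega_lattice A" and B: "complete_omega_lattice B"
    using assms by (simp_all add: completely_distributive_def)
  obtain tA where tA: "distributive_basis A (obj A) (\<lambda>x. x) tA"
    using completely_distributive_basis[OF assms(1)] by blast
  obtain tB where tB: "distributive_basis B (obj B) (\<lambda>x. x) tB"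
    using completely_distributive_basis[OF assms(2)] by blast
  obtain e where basis: "distributive_basis (left_adjoints A B) (obj A \<times> obj B) e (\<lambda>(x, b) f. tB b (f x))"
    using left_adjoints_basis[OF A B tA tB] by blast
  show ?thesis
    using left_adjoints_complete[OF A B] basis by (rule basis_completely_distributive)
qed

end
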